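(* Let $a,q,t,j,t^{*}$ be integers such that $t>0$, $q\ge 2$, $\gcd(t,q)=1$, $t\mid a^2+1$ and $tt^{*}\equiv 1\pmod q$. Put $a'=a+tj$ and $b'=\frac{q(a'^2+1)}{t}$, and suppose $\gcd(a',q)=1$. Then $S(a',b')$, written as a fraction in lowest terms with positive denominator, has denominator $q$, and its numerator is $$qS(a',b')=\lambda(a,t,t^{*})+\Delta(at^{*}+j).$$ Furthermore, $\lambda(a,t,t^{*})\in\mathbb{Z}$ and $\Delta(at^{*}+j)\in\mathbb{Z}$.
   Context: For coprime integers $a,b$ with $b>0$, the Dedekind sum is $s(a,b)=\sum_{k=1}^{b}\left(\!\left(\frac{k}{b}\right)\!\right)\left(\!\left(\frac{ak}{b}\right)\!\right)$, where $((x))=\{x\}-\frac12$ if $x\in\mathbb{R}\setminus\mathbb{Z}$ (with $\{x\}$ the fractional part) and $((x))=0$ if $x\in\mathbb{Z}$. The normalized Dedekind sum is $S(a,b)=12\,s(a,b)$. For a fixed integer $q\ge 2$, define $$\lambda(a,t,t^{*})=\frac{(q^2-1)a}{t}-(q^2-1)at^{*}-qS(aq,t)$$ for all integers $a,t,t^{*}$ with $t>0$, $t\mid a^2+1$ and $tt^{*}\equiv 1\pmod q$, and $$\Delta(\ell)=(q^2-1)\ell+qS(\ell,q)$$ for all integers $\ell$ with $\gcd(\ell,q)=1$. (Under the hypotheses, $\gcd(a+tj,q)=1$ if and only if $\gcd(at^{*}+j,q)=1$, so $\Delta(at^{*}+j)$ is defined.) *)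

theory Defs
  imports Complex_Main "HOL-Number_Theory.Cong"
begin

definition sawtooth :: "real \<Rightarrow> real" where
  "sawtooth x = (if x \<in> \<int> then 0 else frac x - 1 / 2)"

text \<open>The Dedekind sums are intended for \<open>b > 0\<close> and \<open>coprime a b\<close>; outside this
  range the functions below carry no meaning.\<close>

definition dedekind_sum :: "int \<Rightarrow> int \<Rightarrow> real" where
  "dedekind_sum a b =
     (\<Sum>k = 1..b. sawtooth (real_of_int k / real_of_int b) *
                  sawtooth (real_of_int (a * k) / real_of_int b))"

definition normalized_dedekind_sum :: "int \<Rightarrow> int \<Rightarrow> real" where
  "normalized_dedekind_sum a b = 12 * dedekind_sum a b"

text \<open>The modulus \<open>q\<close>, fixed on paper, is the first argument of the next two functions.
  The first is intended for \<open>t > 0\<close>, \<open>t dvd a\<^sup>2 + 1\<close> and \<open>[t * t' = 1] (mod q)\<close>, the second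
  for \<open>coprime l q\<close>.\<close>

definition dedekind_lambda :: "int \<Rightarrow> int \<Rightarrow> int \<Rightarrow> int \<Rightarrow> real" where
  "dedekind_lambda q a t t' =
     real_of_int ((q\<^sup>2 - 1) * a) / real_of_int t - real_of_int ((q\<^sup>2 - 1) * a * t')
       - real_of_int q * normalized_dedekind_sum (a * q) t"

definition dedekind_Delta :: "int \<Rightarrow> int \<Rightarrow> real" where
  "dedekind_Delta q l =
     real_of_int ((q\<^sup>2 - 1) * l) + real_of_int q * normalized_dedekind_sum l q"

end

theory Submission
  imports Defs
begin

text \<open>
  Let \<open>x = a'\<close> and \<open>t * m = x\<^sup>2 + 1\<close>, so that \<open>b' = q * m\<close>. For \<open>x > 0\<close>, reciprocity expresses
  \<open>S(x, q m)\<close> through \<open>S(q m, x)\<close>, and since \<open>m\<close> is the inverse of \<open>t\<close> modulo \<open>x\<close>, the latter occurs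
  in Rademacher's three-term relation for the triple \<open>x, q, t\<close>. The two other terms are
  \<open>- S(x q, t)\<close>, because \<open>x\<^sup>2\<close> is \<open>- 1\<close> modulo \<open>t\<close>, and \<open>S(x t', q)\<close>; all sums are odd in \<open>x\<close>, which
  covers \<open>x < 0\<close>. Integrality and coprimality follow from \<open>a * (b * S(a, b)) \<equiv> a\<^sup>2 + 1\<close> modulo \<open>b\<close>,
  a consequence of reciprocity.

  The three-term relation comes from the periodic function \<open>((a x)) ((b x)) ((c x))\<close>: over one period,
  its jumps (which are Dedekind sums) and the integral of its derivative cancel.
\<close>

section \<open>Homogeneous Dedekind sums\<close>

lemma sawtooth_divide:
  fixes k c :: int
  assumes "c > 0"
  shows "sawtooth (of_int k / of_int c) = (if c dvd k then 0 else of_int (k mod c) / of_int c - 1 / 2)"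
proof -
  have eq: "real_of_int k / of_int c = of_int (k div c) + of_int (k mod c) / of_int c"
  proof -
    have "real_of_int k = of_int (c * (k div c) + k mod c)" by simp
    then show ?thesis
      using assms unfolding of_int_add of_int_mult by (simp add: field_simps)
  qed
  have r: "0 \<le> real_of_int (k mod c) / of_int c" "real_of_int (k mod c) / of_int c < 1"
    using assms by (auto simp: field_simps)
  have "frac (real_of_int k / of_int c) = of_int (k mod c) / of_int c"
    unfolding eq using r by (subst frac_unique_iff) auto
  moreover have "real_of_int k / of_int c \<in> \<int> \<longleftrightarrow> c dvd k"
    using assms of_int_div_of_int_in_Ints_iff[of k c, where 'a = real] by auto
  ultimately show ?thesis by (simp add: sawtooth_def)
qed

text \<open>Two free multipliers make the sum symmetric in \<open>a\<close> and \<open>b\<close> and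
  unchanged under scaling both by a unit modulo \<open>c\<close>; this is the form in which the
  three-term relation is symmetric. The range starts at \<open>0\<close> so that it is a system of
  least residues.\<close>

definition homogeneous_dedekind_sum :: "int \<Rightarrow> int \<Rightarrow> int \<Rightarrow> real" where
  "homogeneous_dedekind_sum a b c =
     (\<Sum>k\<in>{0..<c}. sawtooth (of_int (a * k) / of_int c) * sawtooth (of_int (b * k) / of_int c))"

lemma sawtooth_cong:
  fixes k l c :: int
  assumes "c > 0" "[k = l] (mod c)"
  shows "sawtooth (of_int k / of_int c) = sawtooth (of_int l / of_int c)"
proof -
  have "c dvd k \<longleftrightarrow> c dvd l"
    using assms(2) by (metis cong_def mod_eq_0_iff_dvd)
  with assms show ?thesis by (simp add: sawtooth_divide cong_def)
qed

lemma sawtooth_minus: "sawtooth (- x) = - sawtooth x"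
  by (auto simp: sawtooth_def frac_neg)

lemma dedekind_sum_eq_homogeneous:
  assumes "b > 0"
  shows "dedekind_sum a b = homogeneous_dedekind_sum 1 a b"
proof -
  \<comment> \<open>The end terms \<open>k = b\<close> and \<open>k = 0\<close> both vanish, since
    \<open>sawtooth\<close> is zero at integers.\<close>
  have 1: "{1..b} = insert b {1..<b}" "{0..<b} = insert 0 {1..<b}"
    using assms by auto
  show ?thesis
    unfolding dedekind_sum_def homogeneous_dedekind_sum_def 1
    using assms by (simp add: sawtooth_divide)
qed

lemma homogeneous_dedekind_sum_commute:
  "homogeneous_dedekind_sum a b c = homogeneous_dedekind_sum b a c"
  by (simp add: homogeneous_dedekind_sum_def mult.commute)

lemma homogeneous_dedekind_sum_cong:
  assumes "c > 0" "[a = a'] (mod c)" "[b = b'] (mod c)"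
  shows "homogeneous_dedekind_sum a b c = homogeneous_dedekind_sum a' b' c"
  unfolding homogeneous_dedekind_sum_def using assms
  by (intro sum.cong refl arg_cong2[where f = "(*)"] sawtooth_cong cong_mult cong_refl)

lemma homogeneous_dedekind_sum_minus_left:
  "homogeneous_dedekind_sum (- a) b c = - homogeneous_dedekind_sum a b c"
  by (simp add: homogeneous_dedekind_sum_def sawtooth_minus sum_negf)

lemma homogeneous_dedekind_sum_minus_right:
  "homogeneous_dedekind_sum a (- b) c = - homogeneous_dedekind_sum a b c"
  by (simp add: homogeneous_dedekind_sum_def sawtooth_minus sum_negf)

lemma bij_betw_mult_mod:
  fixes h c :: int
  assumes "c > 0" "coprime h c"
  shows "bij_betw (\<lambda>k. h * k mod c) {0..<c} {0..<c}"
proof -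
  have "inj_on (\<lambda>k. h * k mod c) {0..<c}"
  proof (rule inj_onI)
    fix x y assume *: "x \<in> {0..<c}" "y \<in> {0..<c}" "h * x mod c = h * y mod c"
    then have "[x = y] (mod c)"
      using assms(2) by (simp add: cong_def[symmetric] cong_mult_lcancel)
    then show "x = y"
      using * by (intro cong_less_imp_eq_int) auto
  qed
  moreover have "(\<lambda>k. h * k mod c) ` {0..<c} \<subseteq> {0..<c}"
    using assms by auto
  ultimately show ?thesis
    by (simp add: bij_betw_def endo_inj_surj)
qed

text \<open>Multiplication by a unit \<open>h\<close> only permutes the residues over which the sum
  runs. Later \<open>h\<close> is chosen as an inverse, to bring one multiplier to \<open>1\<close>
  or \<open>- 1\<close>.\<close>

lemma homogeneous_dedekind_sum_mult:
  assumes "c > 0" "coprime h c"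
  shows "homogeneous_dedekind_sum (h * a) (h * b) c = homogeneous_dedekind_sum a b c"
proof -
  have eq: "sawtooth (of_int (h * a * k) / of_int c) = sawtooth (of_int (a * (h * k mod c)) / of_int c)" for a k
  proof (rule sawtooth_cong[OF assms(1)])
    have "a * (h * k mod c) mod c = a * (h * k) mod c" by (rule mod_mult_right_eq)
    also have "a * (h * k) = h * a * k" by simp
    finally show "[h * a * k = a * (h * k mod c)] (mod c)" by (simp only: cong_def)
  qed
  show ?thesis
    unfolding homogeneous_dedekind_sum_def eq
    by (rule sum.reindex_bij_betw[OF bij_betw_mult_mod[OF assms]])
qed

section \<open>Sums over residues and power sums\<close>

lemma sum_mod_mod_coprime:
  fixes b c :: int and f g :: "int \<Rightarrow> real"
  assumes "b > 0" "c > 0" "coprime b c"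
  shows "(\<Sum>k\<in>{0..<b * c}. f (k mod b) * g (k mod c)) = sum f {0..<b} * sum g {0..<c}"
proof -
  \<comment> \<open>By the Chinese remainder theorem this map is a bijection onto the pairs of
    residues; injectivity suffices by counting.\<close>
  let ?h = "\<lambda>k. (k mod b, k mod c)"
  have inj: "inj_on ?h {0..<b * c}"
  proof (rule inj_onI)
    fix x y assume *: "x \<in> {0..<b * c}" "y \<in> {0..<b * c}" "?h x = ?h y"
    then have "[x = y] (mod b * c)"
      using assms(3) by (intro coprime_cong_mult) (auto simp: cong_def)
    with * show "x = y"
      using cong_less_imp_eq_int[of x "b * c" y] by auto
  qed
  have "?h ` {0..<b * c} = {0..<b} \<times> {0..<c}"
  proof (rule card_subset_eq)
    show "?h ` {0..<b * c} \<subseteq> {0..<b} \<times> {0..<c}"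
      using assms by auto
    show "card (?h ` {0..<b * c}) = card ({0..<b} \<times> {0..<c})"
      using assms by (simp add: card_image[OF inj] card_cartesian_product nat_mult_distrib)
  qed auto
  with inj have "bij_betw ?h {0..<b * c} ({0..<b} \<times> {0..<c})"
    by (simp add: bij_betw_def)
  from sum.reindex_bij_betw[OF this, of "\<lambda>(x, y). f x * g y"]
  show ?thesis
    by (simp add: sum_product sum.cartesian_product)
qed

lemma sum_div_mod:
  fixes a m :: int and F :: "int \<Rightarrow> real"
  assumes "a > 0" "m > 0"
  shows "sum F {0..<a * m} = (\<Sum>r\<in>{0..<a}. \<Sum>k\<in>{0..<m}. F (r + a * k))"
proof -
  have "sum F {0..<a * m} = (\<Sum>(r, k)\<in>{0..<a} \<times> {0..<m}. F (r + a * k))"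
  proof (rule sum.reindex_bij_witness[where i = "\<lambda>(r, k). r + a * k" and j = "\<lambda>i. (i mod a, i div a)"])
    fix i assume i: "i \<in> {0..<a * m}"
    have "a * (i div a) \<le> i"
      using assms pos_mod_sign[of a i] mult_div_mod_eq[of a i] by linarith
    also have "i < a * m" using i by simp
    finally have "i div a < m" using assms by simp
    then show "(i mod a, i div a) \<in> {0..<a} \<times> {0..<m}"
      using assms i by (auto simp: pos_imp_zdiv_nonneg_iff)
  next
    fix p assume p: "p \<in> {0..<a} \<times> {0..<m}"
    obtain r k where rk: "p = (r, k)" by force
    have "a * k \<le> a * (m - 1)"
      using p rk assms by (intro mult_left_mono) auto
    then show "(case p of (r, k) \<Rightarrow> r + a * k) \<in> {0..<a * m}"
      using p rk assms by (auto simp: algebra_simps)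
  qed (use assms in auto)
  then show ?thesis by (simp add: sum.cartesian_product)
qed

lemma sum_int_upto: "c \<ge> 0 \<Longrightarrow> (\<Sum>k\<in>{0..<c}. real_of_int k) = of_int c * (of_int c - 1) / 2"
proof (induction c rule: int_ge_induct)
  case (step i)
  have "{0..<i + 1} = insert i {0..<i}" using step by auto
  with step show ?case by (simp add: field_simps)
qed simp

lemma sum_int_square_upto:
  "c \<ge> 0 \<Longrightarrow> (\<Sum>k\<in>{0..<c}. (real_of_int k)\<^sup>2) = of_int c * (of_int c - 1) * (2 * of_int c - 1) / 6"
proof (induction c rule: int_ge_induct)
  case (step i)
  have "{0..<i + 1} = insert i {0..<i}" using step by auto
  with step show ?case by (simp add: field_simps power2_eq_square)
qed simp

section \<open>The three-term relation\<close>

text \<open>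
  If \<open>n = k * m\<close>, then \<open>mod_saw m i\<close> is the limit from the right of \<open>((k x))\<close> at \<open>x = i / n\<close>, and
  \<open>mod_saw m i + 1 / m\<close> is its limit from the left at \<open>x = (i + 1) / n\<close>. This makes the argument by jumps
  a finite computation.
\<close>

definition mod_saw :: "int \<Rightarrow> int \<Rightarrow> real" where
  "mod_saw m i = of_int (i mod m) / of_int m - 1 / 2"

text \<open>The right limits over one period run from \<open>- 1 / 2\<close> to
  \<open>1 / 2 - 1 / m\<close> in steps of \<open>1 / m\<close>, so they add up to
  \<open>- 1 / 2\<close>; there are \<open>a\<close> periods.\<close>

lemma sum_mod_saw:
  assumes "a > 0" "m > 0"
  shows "(\<Sum>i\<in>{0..<a * m}. mod_saw m i) = - of_int a / 2"
proof -
  have "(\<Sum>i\<in>{0..<a * m}. mod_saw m i) = (\<Sum>r\<in>{0..<m}. \<Sum>k\<in>{0..<a}. mod_saw m (r + m * k))"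
    using sum_div_mod[OF assms(2,1), of "mod_saw m"] by (simp add: mult.commute)
  also have "\<dots> = (\<Sum>r\<in>{0..<m}. of_int a * (of_int r / of_int m - 1 / 2))"
    using assms by (intro sum.cong refl) (simp add: mod_saw_def)
  also have "\<dots> = of_int a * ((\<Sum>r\<in>{0..<m}. of_int r) / of_int m - of_int m / 2)"
    using assms by (simp add: sum_distrib_left[symmetric] sum_subtractf sum_divide_distrib[symmetric])
  also have "\<dots> = - of_int a / 2"
    using assms by (simp add: sum_int_upto field_simps)
  finally show ?thesis .
qed

text \<open>Write \<open>i = r + a * k\<close>. For fixed \<open>r\<close> the two factors depend on
  \<open>k mod b\<close> and \<open>k mod c\<close> only, so the sum over \<open>k\<close> splits
  into a product of two sums. Each of them equals \<open>r / a - 1 / 2\<close>, which leaves a sum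
  of squares over \<open>r\<close>.\<close>

lemma sum_mod_saw_mult:
  assumes "a > 0" "b > 0" "c > 0" "coprime b c"
  shows "(\<Sum>i\<in>{0..<a * b * c}. mod_saw (a * b) i * mod_saw (a * c) i) = ((of_int a)\<^sup>2 + 2) / (12 * of_int a)"
proof -
  have ms: "mod_saw (a * m) (r + a * k) = of_int (r + a * (k mod m)) / of_int (a * m) - 1 / 2"
    if "r \<in> {0..<a}" "m > 0" for r k m
  proof -
    have "(r + a * k) mod (a * m) = r + a * (k mod m)"
      using that assms(1)
      by (simp add: zmod_zmult2_eq)
    then show ?thesis by (simp add: mod_saw_def)
  qed
  \<comment> \<open>Distribution relation of the sawtooth function: adding its values at
    \<open>m\<close> equally spaced shifts gives its value at \<open>m\<close> times the
    argument.\<close>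
  have inner: "(\<Sum>x\<in>{0..<m}. of_int (r + a * x) / of_int (a * m) - 1 / 2) = real_of_int r / of_int a - 1 / 2"
    if "m > 0" for m r
  proof -
    have "(\<Sum>x\<in>{0..<m}. of_int (r + a * x) / of_int (a * m) - 1 / 2)
        = (of_int m * of_int r + of_int a * (\<Sum>x\<in>{0..<m}. real_of_int x)) / of_int (a * m) - of_int m / 2"
      using that
      by (simp add: sum_subtractf sum_divide_distrib[symmetric] sum.distrib sum_distrib_left[symmetric])
    also have "\<dots> = real_of_int r / of_int a - 1 / 2"
      using that assms(1) by (simp add: sum_int_upto field_simps)
    finally show ?thesis .
  qed
  have "(\<Sum>i\<in>{0..<a * b * c}. mod_saw (a * b) i * mod_saw (a * c) i)
      = (\<Sum>r\<in>{0..<a}. \<Sum>k\<in>{0..<b * c}. mod_saw (a * b) (r + a * k) * mod_saw (a * c) (r + a * k))"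
    using sum_div_mod[of a "b * c" "\<lambda>i. mod_saw (a * b) i * mod_saw (a * c) i"] assms
    by (simp add: mult.assoc)
  also have "\<dots> = (\<Sum>r\<in>{0..<a}. \<Sum>k\<in>{0..<b * c}.
      (of_int (r + a * (k mod b)) / of_int (a * b) - 1 / 2) * (of_int (r + a * (k mod c)) / of_int (a * c) - 1 / 2))"
    using assms by (intro sum.cong refl) (simp only: ms)
  also have "\<dots> = (\<Sum>r\<in>{0..<a}. (real_of_int r / of_int a - 1 / 2) * (real_of_int r / of_int a - 1 / 2))"
  proof (intro sum.cong refl)
    fix r
    show "(\<Sum>k\<in>{0..<b * c}.
      (of_int (r + a * (k mod b)) / of_int (a * b) - 1 / 2) * (of_int (r + a * (k mod c)) / of_int (a * c) - 1 / 2))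
      = (real_of_int r / of_int a - 1 / 2) * (real_of_int r / of_int a - 1 / 2)"
      using sum_mod_mod_coprime[OF assms(2-4),
          of "\<lambda>x. of_int (r + a * x) / of_int (a * b) - 1 / 2" "\<lambda>x. of_int (r + a * x) / of_int (a * c) - 1 / 2"]
      by (simp only: inner assms(2,3))
  qed
  also have "\<dots> = (\<Sum>r\<in>{0..<a}. (of_int r)\<^sup>2 / (of_int a)\<^sup>2 - of_int r / of_int a + 1 / 4)"
    by (intro sum.cong refl) (simp add: power2_eq_square algebra_simps)
  also have "\<dots> = (\<Sum>r\<in>{0..<a}. (of_int r)\<^sup>2) / (of_int a)\<^sup>2 - (\<Sum>r\<in>{0..<a}. of_int r) / of_int a + of_int a / 4"
    using assms(1) by (simp add: sum_subtractf sum.distrib sum_divide_distrib[symmetric])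
  also have "\<dots> = ((of_int a)\<^sup>2 + 2) / (12 * of_int a)"
    using assms(1) by (simp add: sum_int_upto sum_int_square_upto) (simp add: field_simps power2_eq_square)
  finally show ?thesis .
qed


text \<open>The left and right limits at a division point differ only where the sawtooth falls from
  \<open>1 / 2\<close> to \<open>- 1 / 2\<close>, that is, at multiples of \<open>m\<close>.\<close>

lemma mod_saw_Suc:
  assumes "m > 0"
  shows "mod_saw m i + 1 / of_int m = mod_saw m (i + 1) + of_bool (m dvd i + 1)"
proof -
  have eq: "(i + 1) mod m = (i mod m + 1) mod m" by (simp add: mod_simps)
  show ?thesis
  proof (cases "i mod m + 1 = m")
    case True
    then have "real_of_int (i mod m) = of_int m - 1" by linarith
    moreover have "(i + 1) mod m = 0" using True eq by simp
    ultimately show ?thesis using assms by (simp add: mod_saw_def mod_0_imp_dvd field_simps)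
  next
    case False
    with assms have "i mod m + 1 < m" using pos_mod_bound[of m i] by linarith
    then have "(i + 1) mod m = i mod m + 1" using assms unfolding eq by (intro mod_pos_pos_trivial) auto
    moreover have "i mod m + 1 > 0" using assms pos_mod_sign[of m i] by linarith
    moreover from calculation have "\<not> m dvd i + 1" by (metis dvd_imp_mod_0 less_irrefl)
    ultimately show ?thesis by (simp add: mod_saw_def add_divide_distrib)
  qed
qed

lemma mod_saw_eq_sawtooth:
  assumes "a > 0" "c > 0" "\<not> a dvd k"
  shows "mod_saw (a * c) (c * k) = sawtooth (of_int k / of_int a)"
  using assms by (simp add: mod_saw_def sawtooth_divide mult.commute[of a c] mod_mult_mult1)

text \<open>With \<open>n = a * b * c\<close>, the factor \<open>((a x))\<close> jumps at
  \<open>x = i / n\<close> exactly when \<open>i = b * c * k\<close>, i.e. at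
  \<open>x = k / a\<close>. For \<open>0 < k < a\<close> the two other factors are continuous there,
  by coprimality, and take the values \<open>((c k / a))\<close> and
  \<open>((b k / a))\<close>.\<close>

lemma sum_jumps_mod_saw:
  assumes "a > 0" "b > 0" "c > 0" "coprime a b" "coprime a c"
  shows "(\<Sum>i\<in>{1..<a * b * c}. of_bool (b * c dvd i) * (mod_saw (a * b) i * mod_saw (a * c) i))
       = homogeneous_dedekind_sum b c a"
proof -
  have ndvd: "\<not> a dvd b * k" "\<not> a dvd c * k" if "k \<in> {1..<a}" for k
    using that assms zdvd_not_zless[of k a] by (auto simp: coprime_dvd_mult_right_iff)
  have "(\<Sum>i\<in>{1..<a * b * c}. of_bool (b * c dvd i) * (mod_saw (a * b) i * mod_saw (a * c) i))
      = (\<Sum>i\<in>{i \<in> {1..<a * b * c}. b * c dvd i}. mod_saw (a * b) i * mod_saw (a * c) i)"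
    by (intro sum.mono_neutral_cong_right) auto
  also have "\<dots> = (\<Sum>k\<in>{1..<a}. sawtooth (of_int (c * k) / of_int a) * sawtooth (of_int (b * k) / of_int a))"
  proof (rule sum.reindex_bij_witness[where i = "\<lambda>k. b * c * k" and j = "\<lambda>i. i div (b * c)"])
    fix i assume i: "i \<in> {i \<in> {1..<a * b * c}. b * c dvd i}"
    then obtain k where k: "i = b * c * k" by auto
    have "b * c > 0" using assms by simp
    have "b * c * k < b * c * a" using i k by (simp add: ac_simps)
    then have "k < a" using \<open>b * c > 0\<close> mult_less_cancel_left_pos by blast
    moreover have "0 < k" using i k \<open>b * c > 0\<close> by (metis atLeastLessThan_iff mem_Collect_eq int_one_le_iff_zero_less zero_less_mult_pos)
    ultimately have k': "k \<in> {1..<a}" by simp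
    have ik: "i div (b * c) = k" unfolding k using \<open>b * c > 0\<close> by (intro nonzero_mult_div_cancel_left) linarith
    show "b * c * (i div (b * c)) = i" "i div (b * c) \<in> {1..<a}" using k ik k' by simp_all
    show "sawtooth (of_int (c * (i div (b * c))) / of_int a) * sawtooth (of_int (b * (i div (b * c))) / of_int a)
        = mod_saw (a * b) i * mod_saw (a * c) i"
      unfolding ik k using mod_saw_eq_sawtooth[of a b "c * k"] mod_saw_eq_sawtooth[of a c "b * k"] ndvd[OF k'] assms
      by (simp add: ac_simps)
  next
    fix k assume k: "k \<in> {1..<a}"
    have "b * c > 0" using assms by simp
    show "b * c * k div (b * c) = k" using \<open>b * c > 0\<close> by (intro nonzero_mult_div_cancel_left) linarith
    have "b * c * k < b * c * a" using k \<open>b * c > 0\<close> by (intro mult_strict_left_mono) auto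
    moreover have "0 < b * c * k" using k \<open>b * c > 0\<close> by simp
    ultimately show "b * c * k \<in> {i \<in> {1..<a * b * c}. b * c dvd i}"
      by (simp add: ac_simps)
  qed
  also have "\<dots> = homogeneous_dedekind_sum b c a"
  proof -
    have "{0..<a} = insert 0 {1..<a}" using assms by auto
    then show ?thesis
      unfolding homogeneous_dedekind_sum_def using assms by (simp add: sawtooth_def mult.commute)
  qed
  finally show ?thesis .
qed

text \<open>This excludes simultaneous jumps of two factors strictly inside the period.\<close>

lemma dvd_products_imp_ge:
  fixes a b c i :: int
  assumes "coprime b c" "a > 0" "b * a dvd i" "c * a dvd i" "0 < i"
  shows "a * b * c \<le> i"
proof -
  obtain k where k: "i = a * k" using assms(3) by (metis dvd_def mult.assoc mult.commute)
  have "b dvd k" "c dvd k" using assms k by (auto simp: mult.commute)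
  then have "b * c dvd k" using assms(1) by (simp add: divides_mult)
  then have "a * (b * c) dvd i" unfolding k by simp
  then show ?thesis using zdvd_imp_le[of "a * (b * c)" i] assms(5) by (simp add: mult.assoc)
qed

lemma homogeneous_dedekind_sum_three_term:
  assumes pos: "a > 0" "b > 0" "c > 0" and cop: "coprime a b" "coprime b c" "coprime a c"
  shows "homogeneous_dedekind_sum a b c + homogeneous_dedekind_sum b c a + homogeneous_dedekind_sum c a b
       = - 1 / 4 + real_of_int (a\<^sup>2 + b\<^sup>2 + c\<^sup>2) / (12 * real_of_int (a * b * c))"
proof -
  define n where "n = a * b * c"
  define P where "P = b * c"
  define Q where "Q = a * c"
  define R where "R = a * b"
  have pos': "n > 0" "P > 0" "Q > 0" "R > 0" using pos by (simp_all add: n_def P_def Q_def R_def)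
  have dvd: "P dvd n" "Q dvd n" "R dvd n" by (simp_all add: n_def P_def Q_def R_def)
  define u where "u = mod_saw P"
  define v where "v = mod_saw Q"
  define w where "w = mod_saw R"
  \<comment> \<open>\<open>u i\<close>, \<open>v i\<close>, \<open>w i\<close> are the right limits
    of the three factors at \<open>i / n\<close>, and \<open>g i\<close> is the product of the left
    limits there.\<close>
  define g where "g i = (u i + of_bool (P dvd i)) * (v i + of_bool (Q dvd i)) * (w i + of_bool (R dvd i))" for i
  have "g n = g 0"
    using dvd by (simp add: g_def u_def v_def w_def mod_saw_def)
  have "(\<Sum>i\<in>{0..<n}. g (i + 1)) = (\<Sum>i\<in>{1..<n + 1}. g i)"
    by (rule sum.reindex_bij_witness[where i = "\<lambda>i. i - 1" and j = "\<lambda>i. i + 1"]) auto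
  also have "{1..<n + 1} = insert n {1..<n}" using pos' by auto
  also have "sum g (insert n {1..<n}) = sum g (insert 0 {1..<n})" using \<open>g n = g 0\<close> by simp
  also have "insert 0 {1..<n} = {0..<n}" using pos' by auto
  finally have shift: "(\<Sum>i\<in>{0..<n}. g (i + 1)) = sum g {0..<n}" .
  have "(\<Sum>i\<in>{0..<n}. (u i + 1 / of_int P) * (v i + 1 / of_int Q) * (w i + 1 / of_int R)) = sum g {0..<n}"
    unfolding shift[symmetric] g_def u_def v_def w_def mod_saw_Suc[OF pos'(2)] mod_saw_Suc[OF pos'(3)]
      mod_saw_Suc[OF pos'(4)] ..
  \<comment> \<open>On the left is the total change of the triple product inside the intervals
    between division points, on the right the total of left minus right limits at these points. The
    two sides are now evaluated separately.\<close>
  then have eq: "(\<Sum>i\<in>{0..<n}. (u i + 1 / of_int P) * (v i + 1 / of_int Q) * (w i + 1 / of_int R) - u i * v i * w i)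
      = (\<Sum>i\<in>{0..<n}. g i - u i * v i * w i)"
    by (simp add: sum_subtractf)
  have prods: "(\<Sum>i\<in>{0..<n}. v i * w i) = ((of_int a)\<^sup>2 + 2) / (12 * of_int a)"
      "(\<Sum>i\<in>{0..<n}. u i * w i) = ((of_int b)\<^sup>2 + 2) / (12 * of_int b)"
      "(\<Sum>i\<in>{0..<n}. u i * v i) = ((of_int c)\<^sup>2 + 2) / (12 * of_int c)"
    using sum_mod_saw_mult[OF pos cop(2)] sum_mod_saw_mult[OF pos(2,1,3) cop(3)] sum_mod_saw_mult[OF pos(3,1,2) cop(1)]
    by (simp_all add: n_def u_def v_def w_def P_def Q_def R_def ac_simps)
  have singles: "sum u {0..<n} = - of_int a / 2" "sum v {0..<n} = - of_int b / 2" "sum w {0..<n} = - of_int c / 2"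
    using sum_mod_saw[OF pos(1) pos'(2)] sum_mod_saw[OF pos(2) pos'(3)] sum_mod_saw[OF pos(3) pos'(4)]
    by (simp_all add: n_def u_def v_def w_def P_def Q_def R_def ac_simps)
  have "(\<Sum>i\<in>{0..<n}. (u i + 1 / of_int P) * (v i + 1 / of_int Q) * (w i + 1 / of_int R) - u i * v i * w i)
      = (\<Sum>i\<in>{0..<n}. v i * w i / of_int P + u i * w i / of_int Q + u i * v i / of_int R
          + u i / of_int (Q * R) + v i / of_int (P * R) + w i / of_int (P * Q) + 1 / of_int (P * Q * R))"
    by (intro sum.cong refl) (simp add: algebra_simps add_divide_distrib)
  also have "\<dots> = ((of_int a)\<^sup>2 + 2) / (12 * of_int a) / of_int P + ((of_int b)\<^sup>2 + 2) / (12 * of_int b) / of_int Q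
      + ((of_int c)\<^sup>2 + 2) / (12 * of_int c) / of_int R + (- of_int a / 2) / of_int (Q * R)
      + (- of_int b / 2) / of_int (P * R) + (- of_int c / 2) / of_int (P * Q) + of_int n / of_int (P * Q * R)"
    using pos' by (simp only: sum.distrib sum_divide_distrib[symmetric] prods singles) simp
  \<comment> \<open>Over the common denominator \<open>12 * a * b * c\<close> the constants are
    \<open>6\<close>, \<open>- 18\<close> and \<open>12\<close>, and they cancel.\<close>
  also have "\<dots> = real_of_int (a\<^sup>2 + b\<^sup>2 + c\<^sup>2) / (12 * real_of_int (a * b * c))"
    using pos by (simp add: n_def P_def Q_def R_def field_simps power2_eq_square)
  finally have lhs: "(\<Sum>i\<in>{0..<n}. (u i + 1 / of_int P) * (v i + 1 / of_int Q) * (w i + 1 / of_int R) - u i * v i * w i)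
      = real_of_int (a\<^sup>2 + b\<^sup>2 + c\<^sup>2) / (12 * real_of_int (a * b * c))" .
  \<comment> \<open>Away from \<open>0\<close> at most one factor jumps, so only terms with a single
    jump survive in the expanded product.\<close>
  have jump: "g i - u i * v i * w i = of_bool (P dvd i) * (w i * v i) + of_bool (Q dvd i) * (w i * u i)
      + of_bool (R dvd i) * (v i * u i)" if "i \<in> {1..<n}" for i
  proof -
    have "\<not> (P dvd i \<and> Q dvd i)" "\<not> (P dvd i \<and> R dvd i)" "\<not> (Q dvd i \<and> R dvd i)"
      using that dvd_products_imp_ge[of b a c i] dvd_products_imp_ge[of a c b i] dvd_products_imp_ge[of c b a i] pos cop
      by (auto simp: n_def P_def Q_def R_def ac_simps)
    then show ?thesis by (auto simp: g_def algebra_simps)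
  qed
  have "{0..<n} = insert 0 {1..<n}" using pos' by auto
  then have "(\<Sum>i\<in>{0..<n}. g i - u i * v i * w i) = g 0 - u 0 * v 0 * w 0 + (\<Sum>i\<in>{1..<n}. g i - u i * v i * w i)"
    by simp
  \<comment> \<open>At \<open>0\<close> all three factors jump, from \<open>1 / 2\<close> to
    \<open>- 1 / 2\<close>: the contribution is \<open>1 / 8 + 1 / 8\<close>. This is the source of
    \<open>- 1 / 4\<close> in the relation.\<close>
  also have "g 0 - u 0 * v 0 * w 0 = 1 / 4"
    by (simp add: g_def u_def v_def w_def mod_saw_def)
  also have "(\<Sum>i\<in>{1..<n}. g i - u i * v i * w i) = (\<Sum>i\<in>{1..<n}. of_bool (P dvd i) * (w i * v i))
      + (\<Sum>i\<in>{1..<n}. of_bool (Q dvd i) * (w i * u i)) + (\<Sum>i\<in>{1..<n}. of_bool (R dvd i) * (v i * u i))"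
    by (simp add: jump sum.distrib)
  also have "\<dots> = homogeneous_dedekind_sum b c a + homogeneous_dedekind_sum a c b + homogeneous_dedekind_sum a b c"
    using sum_jumps_mod_saw[OF pos cop(1,3)] sum_jumps_mod_saw[of b a c] sum_jumps_mod_saw[of c a b] pos cop
    by (simp add: n_def u_def v_def w_def P_def Q_def R_def ac_simps)
  finally show ?thesis
    using eq lhs homogeneous_dedekind_sum_commute[of a c b] by simp
qed

lemma homogeneous_dedekind_sum_modulus_1: "homogeneous_dedekind_sum a b 1 = 0"
  by (simp add: homogeneous_dedekind_sum_def sawtooth_divide sawtooth_def)

section \<open>Reciprocity and integrality\<close>

lemma normalized_dedekind_sum_cong:
  assumes "b > 0" "[a = a'] (mod b)"
  shows "normalized_dedekind_sum a b = normalized_dedekind_sum a' b"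
  using assms
  by (simp add: normalized_dedekind_sum_def dedekind_sum_eq_homogeneous
      homogeneous_dedekind_sum_cong[OF assms(1) cong_refl assms(2)])

lemma normalized_dedekind_sum_minus:
  "b > 0 \<Longrightarrow> normalized_dedekind_sum (- a) b = - normalized_dedekind_sum a b"
  by (simp add: normalized_dedekind_sum_def dedekind_sum_eq_homogeneous homogeneous_dedekind_sum_minus_right)

text \<open>The three-term relation with third modulus \<open>1\<close>, whose Dedekind sum
  vanishes.\<close>

lemma dedekind_reciprocity:
  assumes "a > 0" "b > 0" "coprime a b"
  shows "normalized_dedekind_sum a b + normalized_dedekind_sum b a
       = - 3 + real_of_int (a\<^sup>2 + b\<^sup>2 + 1) / real_of_int (a * b)"
  using homogeneous_dedekind_sum_three_term[of a b 1] assms homogeneous_dedekind_sum_commute[of b 1 a]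
  by (simp add: homogeneous_dedekind_sum_modulus_1 normalized_dedekind_sum_def dedekind_sum_eq_homogeneous)

text \<open>After replacing \<open>a * k mod b\<close> by \<open>a * k - b * (a * k div b)\<close>,
  the only terms that need not be integers are \<open>12 * a / b * k\<^sup>2\<close>. The closed
  form of the sum of squares supplies the factor \<open>b / 6\<close> that clears them.\<close>

lemma dedekind_sum_integral:
  assumes "b > 0" "coprime a b"
  shows "real_of_int b * normalized_dedekind_sum a b \<in> \<int>"
proof -
  have *: "{0..<b} = insert 0 {1..<b}" using assms by auto
  have ndvd: "\<not> b dvd k" "\<not> b dvd a * k" if "k \<in> {1..<b}" for k
    using that assms zdvd_not_zless[of k b] by (auto simp: coprime_dvd_mult_right_iff coprime_commute)
  have expand: "12 * B * ((x / B - 1 / 2) * ((A * x - B * D) / B - 1 / 2))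
      = 12 * A / B * x\<^sup>2 + (3 * B - 12 * x * D - 6 * x - 6 * (A * x - B * D))"
    if "B \<noteq> 0" for A B D x :: real
    using that by (simp add: field_simps power2_eq_square)
  \<comment> \<open>The subtracted \<open>1 / 4\<close> is the product
    \<open>(- 1 / 2) * (- 1 / 2)\<close> that the formula on the right gives at
    \<open>k = 0\<close>, where the sawtooth is zero.\<close>
  have "dedekind_sum a b
      = (\<Sum>k\<in>{0..<b}. (of_int k / of_int b - 1 / 2) * (of_int (a * k mod b) / of_int b - 1 / 2)) - 1 / 4"
    unfolding dedekind_sum_eq_homogeneous[OF assms(1)] homogeneous_dedekind_sum_def *
    using assms(1) ndvd by (simp add: sawtooth_divide sawtooth_def[of 0] del: of_int_mult)
  then have "real_of_int b * normalized_dedekind_sum a b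
      = 12 * of_int b * (\<Sum>k\<in>{0..<b}. (of_int k / of_int b - 1 / 2) * (of_int (a * k mod b) / of_int b - 1 / 2))
        - 3 * of_int b"
    unfolding normalized_dedekind_sum_def by (simp only: right_diff_distrib)
  also have "\<dots> = (\<Sum>k\<in>{0..<b}. 12 * of_int b * ((of_int k / of_int b - 1 / 2) * (of_int (a * k mod b) / of_int b - 1 / 2)))
        - 3 * of_int b"
    by (simp only: sum_distrib_left)
  also have "\<dots> = (\<Sum>k\<in>{0..<b}. 12 * of_int a / of_int b * (of_int k)\<^sup>2
      + of_int (3 * b - 12 * k * (a * k div b) - 6 * k - 6 * (a * k mod b))) - 3 * of_int b"
  proof (intro arg_cong2[where f = "(-)"] sum.cong refl)
    fix k
    have "a * k = b * (a * k div b) + a * k mod b" by simp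
    then have "real_of_int (a * k) = of_int (b * (a * k div b) + a * k mod b)" by (rule arg_cong)
    then have m: "real_of_int (a * k mod b) = of_int a * of_int k - of_int b * of_int (a * k div b)"
      unfolding of_int_add of_int_mult by linarith
    show "12 * of_int b * ((of_int k / of_int b - 1 / 2) * (of_int (a * k mod b) / of_int b - 1 / 2))
      = 12 * of_int a / of_int b * (of_int k)\<^sup>2
      + real_of_int (3 * b - 12 * k * (a * k div b) - 6 * k - 6 * (a * k mod b))"
      unfolding of_int_diff of_int_mult of_int_numeral m using assms(1) by (intro expand) simp
  qed
  also have "\<dots> = of_int (2 * a * (b - 1) * (2 * b - 1)
      + (\<Sum>k\<in>{0..<b}. 3 * b - 12 * k * (a * k div b) - 6 * k - 6 * (a * k mod b)) - 3 * b)"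
  proof -
    have "(\<Sum>k\<in>{0..<b}. 12 * real_of_int a / of_int b * (of_int k)\<^sup>2) = of_int (2 * a * (b - 1) * (2 * b - 1))"
      unfolding sum_distrib_left[of "12 * real_of_int a / of_int b", symmetric]
      using assms(1) by (simp add: sum_int_square_upto)
    then show ?thesis by (simp only: sum.distrib of_int_add of_int_diff of_int_sum)
  qed
  finally show ?thesis by (simp only: Ints_of_int)
qed

text \<open>Reciprocity multiplied by \<open>a * b\<close> is an identity between integers, by
  integrality of both sums; it is then reduced modulo \<open>b\<close>.\<close>

lemma dedekind_sum_mod_self:
  assumes "b > 0" "coprime a b"
  obtains N where "real_of_int b * normalized_dedekind_sum a b = of_int N" "[a * N = a\<^sup>2 + 1] (mod b)"
proof -
  \<comment> \<open>reciprocity needs a positive representative of \<open>a\<close>, also when \<open>b = 1\<close>\<close>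
  define c where "c = a mod b + b"
  have c: "c > 0" "[c = a] (mod b)"
    using assms(1) pos_mod_sign[of b a] by (auto simp: c_def cong_def simp del: pos_mod_sign intro: add_nonneg_pos)
  have cop: "coprime c b"
    using assms(2) c(2) cong_imp_coprime cong_sym by blast
  obtain N where N: "real_of_int b * normalized_dedekind_sum c b = of_int N"
    using dedekind_sum_integral[OF assms(1) cop] by (auto elim: Ints_cases)
  obtain M where M: "real_of_int c * normalized_dedekind_sum b c = of_int M"
    using dedekind_sum_integral[OF c(1)] cop by (auto elim: Ints_cases simp: coprime_commute)
  have "real_of_int (c * N + b * M)
      = of_int (c * b) * (normalized_dedekind_sum c b + normalized_dedekind_sum b c)"
    by (simp add: N[symmetric] M[symmetric] algebra_simps)
  also have "\<dots> = of_int (c\<^sup>2 + b\<^sup>2 + 1 - 3 * c * b)"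
    unfolding dedekind_reciprocity[OF c(1) assms(1) cop] using c(1) assms(1) by (simp add: field_simps)
  finally have "c * N + b * M = c\<^sup>2 + b\<^sup>2 + 1 - 3 * c * b" by linarith
  then have "c * N = c\<^sup>2 + 1 + b * (b - 3 * c - M)" by (simp add: algebra_simps power2_eq_square)
  then have "[c * N = c\<^sup>2 + 1] (mod b)" by (simp add: cong_def)
  then have "[a * N = a\<^sup>2 + 1] (mod b)"
    using c(2) by (meson cong_add cong_mult cong_pow cong_refl cong_sym cong_trans)
  moreover have "real_of_int b * normalized_dedekind_sum a b = of_int N"
    using N normalized_dedekind_sum_cong[OF assms(1) c(2)] by simp
  ultimately show ?thesis by (rule that[rotated])
qed

section \<open>The modulus \<open>q (x\<^sup>2 + 1) / t\<close>\<close>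

text \<open>Reciprocity for \<open>x\<close> and \<open>q * m\<close> and the three-term relation
  for \<open>x\<close>, \<open>q\<close>, \<open>t\<close> both contain \<open>S(q m, x)\<close> and
  the constant \<open>- 3\<close>. Subtracting removes both.\<close>

lemma normalized_dedekind_sum_quotient_pos:
  fixes x q t m t' :: int
  assumes "x > 0" "q > 0" "t > 0" "t * m = x\<^sup>2 + 1" "coprime t q" "coprime x q" "[t * t' = 1] (mod q)"
  shows "normalized_dedekind_sum x (q * m)
       = of_int ((q\<^sup>2 - 1) * x) / of_int (q * t) - normalized_dedekind_sum (x * q) t
         + normalized_dedekind_sum (x * t') q"
proof -
  have tm: "t * m = x * x + 1" using assms(4) by (simp add: power2_eq_square)
  have "m > 0"
    using assms(3,4) by (metis add_nonneg_pos zero_le_power2 zero_less_mult_pos zero_less_one)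
  have cop1: "coprime x (t * m)"
    unfolding tm by (metis coprime_add_one_right coprime_mult_left_iff)
  then have cop: "coprime x t" "coprime x m" by auto
  have qm: "q * m > 0" "coprime x (q * m)" using assms cop \<open>m > 0\<close> by auto
  have "[q * m * t = q] (mod x)"
  proof -
    have "q * m * t - q = q * (t * m) - q" by simp
    also have "\<dots> = x * (x * q)" unfolding tm by (simp add: algebra_simps)
    finally show ?thesis by (simp add: cong_iff_dvd_diff)
  qed
  have r1: "homogeneous_dedekind_sum q t x = homogeneous_dedekind_sum 1 (q * m) x"
  proof -
    have "homogeneous_dedekind_sum 1 (q * m) x = homogeneous_dedekind_sum (t * 1) (t * (q * m)) x"
      using homogeneous_dedekind_sum_mult[of x t 1 "q * m"] assms(1) cop by (simp add: coprime_commute)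
    also have "\<dots> = homogeneous_dedekind_sum t q x"
      using \<open>[q * m * t = q] (mod x)\<close> assms(1) by (intro homogeneous_dedekind_sum_cong) (simp_all add: ac_simps)
    finally show ?thesis by (simp add: homogeneous_dedekind_sum_commute)
  qed
  \<comment> \<open>Multiplying both multipliers by \<open>x\<close> turns the first into
    \<open>x\<^sup>2\<close>, which is \<open>- 1\<close> modulo \<open>t\<close>.\<close>
  have r2: "homogeneous_dedekind_sum x q t = - homogeneous_dedekind_sum 1 (x * q) t"
  proof -
    have "homogeneous_dedekind_sum x q t = homogeneous_dedekind_sum (x * x) (x * q) t"
      using homogeneous_dedekind_sum_mult[of t x x q] assms(3) cop by simp
    also have "\<dots> = homogeneous_dedekind_sum (- 1) (x * q) t"
    proof (rule homogeneous_dedekind_sum_cong)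
      have "t dvd x * x - (- 1)" by (metis tm diff_minus_eq_add dvd_triv_left)
      then show "[x * x = - 1] (mod t)" by (simp only: cong_iff_dvd_diff)
    qed (use assms(3) in auto)
    finally show ?thesis by (simp add: homogeneous_dedekind_sum_minus_left)
  qed
  have r3: "homogeneous_dedekind_sum t x q = homogeneous_dedekind_sum 1 (x * t') q"
  proof -
    have "coprime t' q"
      using assms(7) by (metis coprime_iff_invertible_int mult.commute)
    then have "homogeneous_dedekind_sum t x q = homogeneous_dedekind_sum (t' * t) (t' * x) q"
      using homogeneous_dedekind_sum_mult[of q t' t x] assms(2) by simp
    also have "\<dots> = homogeneous_dedekind_sum 1 (x * t') q"
      using assms(2,7) by (intro homogeneous_dedekind_sum_cong) (simp_all add: ac_simps)
    finally show ?thesis .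
  qed
  have three: "12 * homogeneous_dedekind_sum 1 (x * t') q + 12 * homogeneous_dedekind_sum 1 (q * m) x
      - 12 * homogeneous_dedekind_sum 1 (x * q) t
      = - 3 + real_of_int (x\<^sup>2 + q\<^sup>2 + t\<^sup>2) / real_of_int (x * q * t)"
  proof -
    have "12 * (homogeneous_dedekind_sum x q t + homogeneous_dedekind_sum q t x + homogeneous_dedekind_sum t x q)
        = 12 * (- 1 / 4 + real_of_int (x\<^sup>2 + q\<^sup>2 + t\<^sup>2) / (12 * real_of_int (x * q * t)))"
      using assms cop by (subst homogeneous_dedekind_sum_three_term) (auto simp: coprime_commute)
    also have "\<dots> = - 3 + real_of_int (x\<^sup>2 + q\<^sup>2 + t\<^sup>2) / real_of_int (x * q * t)"
      using assms(1-3) by (simp add: field_simps)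
    finally show ?thesis unfolding r1 r2 r3 by simp
  qed
  have two: "12 * homogeneous_dedekind_sum 1 x (q * m) + 12 * homogeneous_dedekind_sum 1 (q * m) x
      = - 3 + real_of_int (x\<^sup>2 + (q * m)\<^sup>2 + 1) / real_of_int (x * (q * m))"
    using dedekind_reciprocity[OF assms(1) qm] assms(1) qm(1)
    by (simp add: normalized_dedekind_sum_def dedekind_sum_eq_homogeneous)
  have mt: "real_of_int m = ((of_int x)\<^sup>2 + 1) / of_int t"
    using arg_cong[OF assms(4), of real_of_int] assms(3) by (simp add: field_simps)
  have nz: "real_of_int x > 0" "real_of_int q > 0" "real_of_int t > 0"
    using assms by auto
  have "real_of_int (x\<^sup>2 + (q * m)\<^sup>2 + 1) / real_of_int (x * (q * m))
      = of_int t / (of_int x * of_int q) + of_int q * ((of_int x)\<^sup>2 + 1) / (of_int x * of_int t)"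
  proof -
    \<comment> \<open>Using \<open>x\<^sup>2 + 1 = t * m\<close> in the numerator lets
      \<open>m\<close> cancel; the remaining \<open>m\<close> is then eliminated by
      \<open>mt\<close>.\<close>
    have num: "real_of_int (x\<^sup>2 + (q * m)\<^sup>2 + 1) = of_int m * of_int t + (of_int q * of_int m)\<^sup>2"
      using arg_cong[OF assms(4), of real_of_int] by (simp add: algebra_simps)
    have "real_of_int (x\<^sup>2 + (q * m)\<^sup>2 + 1) / real_of_int (x * (q * m))
        = of_int t / (of_int x * of_int q) + of_int q * of_int m / of_int x"
      unfolding num using nz \<open>m > 0\<close> by (simp add: field_simps power2_eq_square)
    then show ?thesis by (simp add: mt ac_simps)
  qed
  also have "\<dots> - real_of_int (x\<^sup>2 + q\<^sup>2 + t\<^sup>2) / real_of_int (x * q * t) = of_int ((q\<^sup>2 - 1) * x) / of_int (q * t)"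
    using nz by (simp add: field_simps power2_eq_square)
  finally show ?thesis
    using three two assms qm(1) by (simp add: normalized_dedekind_sum_def dedekind_sum_eq_homogeneous)
qed

lemma normalized_dedekind_sum_quotient:
  fixes x q t m t' :: int
  assumes "x \<noteq> 0" "q > 0" "t > 0" "t * m = x\<^sup>2 + 1" "coprime t q" "coprime x q" "[t * t' = 1] (mod q)"
  shows "normalized_dedekind_sum x (q * m)
       = of_int ((q\<^sup>2 - 1) * x) / of_int (q * t) - normalized_dedekind_sum (x * q) t
         + normalized_dedekind_sum (x * t') q"
proof (cases "x > 0")
  case True
  then show ?thesis using assms by (intro normalized_dedekind_sum_quotient_pos)
next
  case False
  have "m > 0"
    using assms(3,4) by (metis add_nonneg_pos zero_le_power2 zero_less_mult_pos zero_less_one)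
  then have "q * m > 0" using assms(2) by simp
  with False show ?thesis
    using normalized_dedekind_sum_quotient_pos[of "- x" q t m t'] assms
    by (simp add: normalized_dedekind_sum_minus)
qed

section \<open>Numerator and denominator of \<open>S(a', b')\<close>\<close>

theorem proposition3p3:
  fixes a q t j t' a' b' :: int
  assumes "t > 0" and "q \<ge> 2" and "coprime t q"
    and "t dvd a\<^sup>2 + 1"
    and "[t * t' = 1] (mod q)"
    and "a' = a + t * j"
    and "b' = (q * (a'\<^sup>2 + 1)) div t"
    and "coprime a' q"
  shows "(\<exists>n::int. coprime n q
            \<and> normalized_dedekind_sum a' b' = real_of_int n / real_of_int q
            \<and> real_of_int n = dedekind_lambda q a t t' + dedekind_Delta q (a * t' + j))
       \<and> dedekind_lambda q a t t' \<in> \<int>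
       \<and> dedekind_Delta q (a * t' + j) \<in> \<int>"
proof -
  define l where "l = a * t' + j"
  have "q > 0" using assms(2) by simp
  have "t dvd a'\<^sup>2 + 1"
  proof -
    have "a'\<^sup>2 + 1 = (a\<^sup>2 + 1) + t * (2 * a * j + t * j\<^sup>2)"
      unfolding assms(6) by (simp add: power2_eq_square algebra_simps)
    then show ?thesis using assms(4) by (metis dvd_add dvd_triv_left)
  qed
  then obtain m where m: "a'\<^sup>2 + 1 = t * m" by auto
  have b': "b' = q * m" unfolding assms(7) m using assms(1) by simp
  \<comment> \<open>For \<open>a' = 0\<close>, coprimality to \<open>q\<close> would make
    \<open>q\<close> a unit, against \<open>q \<ge> 2\<close>.\<close>
  have "a' \<noteq> 0" using assms(2,8) by auto
  have "[a' * t' = l] (mod q)"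
  proof -
    have "[a * t' + j * (t * t') = a * t' + j * 1] (mod q)"
      using assms(5) by (intro cong_add cong_mult cong_refl)
    then show ?thesis by (simp add: l_def assms(6) algebra_simps)
  qed
  have "coprime t' q"
    using assms(5) by (metis coprime_iff_invertible_int mult.commute)
  then have cop_l: "coprime l q"
    using assms(8) \<open>[a' * t' = l] (mod q)\<close> by (metis cong_imp_coprime coprime_mult_left_iff)
  have "coprime a t"
  proof (rule coprimeI)
    fix d assume "d dvd a" "d dvd t"
    then have "d dvd a\<^sup>2" "d dvd a\<^sup>2 + 1" using assms(4) by (auto simp: power2_eq_square intro: dvd_trans)
    then show "is_unit d" by (simp add: dvd_add_right_iff)
  qed
  have "coprime (a * q) t" using \<open>coprime a t\<close> assms(3) by (simp add: coprime_commute)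
  obtain M where M: "real_of_int t * normalized_dedekind_sum (a * q) t = of_int M"
      "[a * q * M = (a * q)\<^sup>2 + 1] (mod t)"
    using dedekind_sum_mod_self[OF assms(1) \<open>coprime (a * q) t\<close>] .
  obtain N where N: "real_of_int q * normalized_dedekind_sum l q = of_int N" "[l * N = l\<^sup>2 + 1] (mod q)"
    using dedekind_sum_mod_self[OF \<open>q > 0\<close> cop_l] .
  \<comment> \<open>\<open>L\<close> is \<open>t\<close> times lambda. Divisibility by
    \<open>t\<close> gives integrality of lambda; divisibility by \<open>q\<close> makes lambda
    vanish modulo \<open>q\<close>.\<close>
  define L where "L = (q\<^sup>2 - 1) * a - (q\<^sup>2 - 1) * a * t' * t - q * M"
  have L: "real_of_int L = of_int t * dedekind_lambda q a t t'"
  proof -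
    have "of_int t * dedekind_lambda q a t t' = of_int ((q\<^sup>2 - 1) * a) - of_int t * of_int ((q\<^sup>2 - 1) * a * t')
        - of_int q * (real_of_int t * normalized_dedekind_sum (a * q) t)"
      unfolding dedekind_lambda_def right_diff_distrib using assms(1) by (simp add: mult.left_commute)
    then show ?thesis unfolding M(1) L_def by (simp add: mult.commute)
  qed
  have "t dvd L"
  proof -
    obtain s where s: "a * q * M = (a * q)\<^sup>2 + 1 + t * s"
      using M(2) by (metis cong_iff_lin cong_sym)
    \<comment> \<open>Since \<open>a\<close> is a unit modulo \<open>t\<close>, it is enough to
      treat \<open>a * L\<close>. There the congruence for \<open>a * q * M\<close> cancels the
      terms in \<open>q\<^sup>2 * a\<^sup>2\<close> and leaves \<open>- (a\<^sup>2 + 1)\<close>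
      modulo \<open>t\<close>.\<close>
    have "a * L = - (a\<^sup>2 + 1) - t * ((q\<^sup>2 - 1) * a\<^sup>2 * t' + s)"
    proof -
      have "a * L = (q\<^sup>2 - 1) * a\<^sup>2 - t * ((q\<^sup>2 - 1) * a\<^sup>2 * t') - a * q * M"
        by (simp add: L_def power2_eq_square algebra_simps)
      then show ?thesis unfolding s by (simp add: power2_eq_square algebra_simps)
    qed
    then have "t dvd a * L" using assms(4) by (metis dvd_diff dvd_minus_iff dvd_triv_left)
    then show ?thesis using \<open>coprime a t\<close> by (simp add: coprime_dvd_mult_right_iff coprime_commute)
  qed
  then obtain K where K: "L = t * K" by auto
  have lam: "dedekind_lambda q a t t' = of_int K"
    using L K assms(1) by simp
  have "q dvd L"
  proof -
    obtain s where s: "t * t' = 1 + q * s"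
      using assms(5) by (metis cong_iff_lin cong_sym)
    have "L = (q\<^sup>2 - 1) * a * (1 - t * t') - q * M" by (simp add: L_def algebra_simps)
    also have "\<dots> = q * (- (q\<^sup>2 - 1) * a * s - M)" unfolding s by (simp add: algebra_simps)
    finally show ?thesis by simp
  qed
  then have "q dvd K" using K assms(3) by (simp add: coprime_dvd_mult_right_iff coprime_commute)
  have Del: "dedekind_Delta q l = of_int ((q\<^sup>2 - 1) * l + N)"
    by (simp add: dedekind_Delta_def N(1))
  define n where "n = K + ((q\<^sup>2 - 1) * l + N)"
  \<comment> \<open>Modulo \<open>q\<close>, \<open>K\<close> vanishes and
    \<open>q\<^sup>2 - 1\<close> becomes \<open>- 1\<close>, so \<open>l * n\<close> reduces to
    \<open>- l\<^sup>2 + l * N\<close>, which is \<open>1\<close>. Thus \<open>n\<close> is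
    invertible modulo \<open>q\<close>, and the fraction is in lowest terms.\<close>
  have "[l * n = 1] (mod q)"
  proof -
    obtain s where s: "l * N = l\<^sup>2 + 1 + q * s"
      using N(2) by (metis cong_iff_lin cong_sym)
    obtain r where r: "K = q * r" using \<open>q dvd K\<close> by auto
    have "l * n = l * K + (q\<^sup>2 - 1) * l\<^sup>2 + l * N" by (simp add: n_def power2_eq_square algebra_simps)
    also have "\<dots> = 1 + q * (l * r + q * l\<^sup>2 + s)" unfolding s r by (simp add: power2_eq_square algebra_simps)
    finally show ?thesis by (simp add: cong_def)
  qed
  then have "coprime n q" by (metis coprime_iff_invertible_int mult.commute)
  moreover have n: "real_of_int n = dedekind_lambda q a t t' + dedekind_Delta q (a * t' + j)"
    using lam Del by (simp add: n_def l_def)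
  moreover have "normalized_dedekind_sum a' b' = real_of_int n / real_of_int q"
  proof -
    have "[a' * q = a * q] (mod t)" by (simp add: assms(6) cong_iff_dvd_diff algebra_simps)
    then have "normalized_dedekind_sum a' b' = of_int ((q\<^sup>2 - 1) * a') / of_int (q * t)
        - normalized_dedekind_sum (a * q) t + normalized_dedekind_sum l q"
      using normalized_dedekind_sum_quotient[OF \<open>a' \<noteq> 0\<close> \<open>q > 0\<close> assms(1) m[symmetric] assms(3,8,5)]
        normalized_dedekind_sum_cong[OF assms(1)] normalized_dedekind_sum_cong[OF \<open>q > 0\<close> \<open>[a' * t' = l] (mod q)\<close>]
      unfolding b' by simp
    \<comment> \<open>Here \<open>a' / t = a / t + j\<close>; the terms
      \<open>(q\<^sup>2 - 1) * a * t'\<close> in lambda and Delta cancel in the sum.\<close>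
    then show ?thesis
      unfolding n dedekind_lambda_def dedekind_Delta_def l_def[symmetric] assms(6)
      using assms(1) \<open>q > 0\<close> by (simp add: l_def field_simps)
  qed
  ultimately show ?thesis
    using lam Del unfolding l_def by auto
qed

end
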